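(* For every integer $d\ge 1$ there exists a compact Kakeya set $K\subseteq\mathbb{R}^d$ with $\dim_{tH}K=1$.
   Context: A subset of $\mathbb{R}^d$ is called a Kakeya set if it contains a non-degenerate line segment in every direction. $\dim_H$ denotes Hausdorff dimension, with the convention $\dim_H\emptyset=-1$. The topological Hausdorff dimension is defined by $\dim_{tH}\emptyset=-1$ and, for a non-empty metric space $X$, $\dim_{tH}X=\inf\{d: X \text{ has a basis } \mathcal U \text{ of open sets such that } \dim_H\partial U\le d-1 \text{ for every } U\in\mathcal U\}$ (where $d=\infty$ is allowed, with $\infty-1=\infty$). Subsets of $\mathbb{R}^d$ carry the Euclidean metric. *)

theory Defs
  imports "HOL-Analysis.Analysis"
begin

text \<open>
  The \<open>s\<close>-th power of the diameter, with the usual conventions for \<open>s = 0\<close>: the empty set has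
  weight \<open>0\<close>, every non-empty set has weight \<open>1\<close>. The case distinction is needed because
  \<open>0 powr 0 = 0\<close>. Only meaningful for bounded \<open>U\<close>, as the library's \<open>diameter\<close> is
  unspecified on unbounded sets.
\<close>

definition diameter_weight :: "real \<Rightarrow> 'a::metric_space set \<Rightarrow> ennreal" where
  "diameter_weight s U =
     (if U = {} then 0 else if s = 0 then 1 else ennreal (diameter U powr s))"

definition hausdorff_premeasure :: "real \<Rightarrow> real \<Rightarrow> 'a::metric_space set \<Rightarrow> ennreal" where
  "hausdorff_premeasure \<delta> s A =
     (INF U \<in> {U :: nat \<Rightarrow> 'a set. A \<subseteq> (\<Union>i. U i) \<and> (\<forall>i. bounded (U i) \<and> diameter (U i) \<le> \<delta>)}.
        \<Sum>i. diameter_weight s (U i))"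

definition hausdorff_measure :: "real \<Rightarrow> 'a::metric_space set \<Rightarrow> ennreal" where
  "hausdorff_measure s A = (SUP \<delta> \<in> {0<..}. hausdorff_premeasure \<delta> s A)"

definition hausdorff_dim :: "'a::metric_space set \<Rightarrow> ereal" where
  "hausdorff_dim A =
     (if A = {} then - 1 else Inf {ereal s | s. 0 \<le> s \<and> hausdorff_measure s A = 0})"

definition base_of_topology :: "'a topology \<Rightarrow> 'a set set \<Rightarrow> bool" where
  "base_of_topology T \<U> \<longleftrightarrow>
     (\<forall>U\<in>\<U>. openin T U) \<and>
     (\<forall>V x. openin T V \<and> x \<in> V \<longrightarrow> (\<exists>U\<in>\<U>. x \<in> U \<and> U \<subseteq> V))"

text \<open>
  \<open>X\<close> is regarded as a metric space in its own right: basis and boundaries are taken in the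
  subspace topology. Values \<open>d < 0\<close> never contribute to the infimum: a basis of a non-empty
  space is non-empty, and \<open>hausdorff_dim\<close> is at least \<open>-1\<close>.
\<close>

definition top_hausdorff_dim :: "'a::metric_space set \<Rightarrow> ereal" where
  "top_hausdorff_dim X =
     (if X = {} then - 1
      else Inf {d :: ereal. \<exists>\<U>. base_of_topology (top_of_set X) \<U> \<and>
                  (\<forall>U\<in>\<U>. hausdorff_dim (top_of_set X frontier_of U) \<le> d - 1)})"

definition kakeya_set :: "'a::real_normed_vector set \<Rightarrow> bool" where
  "kakeya_set K \<longleftrightarrow>
     (\<forall>v. norm v = 1 \<longrightarrow> (\<exists>a r. 0 < r \<and> closed_segment a (a + r *\<^sub>R v) \<subseteq> K))"

end

theory Submission
  imports Defs
begin

text \<open>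
  If every slice \<open>K \<inter> {x. x $ i = t}\<close> with rational \<open>t\<close> has Hausdorff dimension at most \<open>0\<close>, then
  small boxes with rational coordinates form a basis of \<open>K\<close> with boundaries of dimension at
  most \<open>0\<close>. To serve the directions \<open>v \<in> [1, 2]\<^sup>n\<close> by such a \<open>K\<close>, take the closure of the segments
  \<open>[a v, a v + v]\<close> for a generic bounded (discontinuous) function \<open>a\<close>. These segments are uniformly
  transversal to all coordinate hyperplanes, and a small parallel displacement of the lines makes
  them meet a given hyperplane in finitely many points only. A generic \<open>a\<close> therefore has all
  rational slices covered very efficiently. Finitely many rotated and disjointly translated copies
  of \<open>K\<close> serve all directions. Conversely, a set containing a segment has no basis of clopen sets.
\<close>

subsection \<open>Thin sets\<close>

text \<open>A single \<open>e\<close> bounds the radii, the exponent and the weight of the cover. All radii being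
  below \<open>1\<close> for small \<open>e\<close>, weights with larger exponents are then small as well.\<close>

definition thin_cover :: "real \<Rightarrow> 'a::metric_space set \<Rightarrow> bool" where
  "thin_cover e A \<longleftrightarrow>
     (\<exists>xs. A \<subseteq> (\<Union>(p, r)\<in>set xs. cball p r) \<and> (\<forall>(p, r)\<in>set xs. 0 < r \<and> r \<le> e) \<and>
           (\<Sum>(p, r)\<leftarrow>xs. r powr e) \<le> e)"

definition thin :: "'a::metric_space set \<Rightarrow> bool" where
  "thin A \<longleftrightarrow> (\<forall>e>0. thin_cover e A)"

lemma thin_cover_subset: "thin_cover e B \<Longrightarrow> A \<subseteq> B \<Longrightarrow> thin_cover e A"
  unfolding thin_cover_def by (meson subset_trans)

lemma thin_subset: "thin B \<Longrightarrow> A \<subseteq> B \<Longrightarrow> thin A"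
  unfolding thin_def by (blast intro: thin_cover_subset)

lemma sum_powr_antimono:
  assumes "\<forall>(p, r)\<in>set xs. 0 < r \<and> r \<le> 1" and "s \<le> t"
  shows "(\<Sum>(p, r)\<leftarrow>xs. r powr t) \<le> (\<Sum>(p, r)\<leftarrow>xs. r powr (s::real))"
proof (rule sum_list_mono)
  fix x assume "x \<in> set xs"
  then show "(case x of (p, r) \<Rightarrow> r powr t) \<le> (case x of (p, r) \<Rightarrow> r powr s)"
    using assms by (auto split: prod.splits intro!: powr_mono')
qed

lemma thin_cover_mono:
  assumes "thin_cover d A" "d \<le> e" "d \<le> 1"
  shows "thin_cover e A"
proof -
  obtain xs where xs: "A \<subseteq> (\<Union>(p, r)\<in>set xs. cball p r)" "\<forall>(p, r)\<in>set xs. 0 < r \<and> r \<le> d"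
      "(\<Sum>(p, r)\<leftarrow>xs. r powr d) \<le> d"
    using assms(1) unfolding thin_cover_def by meson
  have "(\<Sum>(p, r)\<leftarrow>xs. r powr e) \<le> (\<Sum>(p, r)\<leftarrow>xs. r powr d)"
    by (rule sum_powr_antimono) (use xs(2) assms in fastforce)+
  also have "\<dots> \<le> e" using xs(3) assms(2) by linarith
  finally have "(\<Sum>(p, r)\<leftarrow>xs. r powr e) \<le> e" .
  moreover have "\<forall>(p, r)\<in>set xs. 0 < r \<and> r \<le> e" using xs(2) assms(2) by fastforce
  ultimately show ?thesis using xs(1) unfolding thin_cover_def by blast
qed

lemma thin_empty [simp]: "thin {}"
  unfolding thin_def thin_cover_def by (auto intro!: exI[of _ "[]"])

lemma thin_Un:
  assumes "thin A" "thin B"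
  shows "thin (A \<union> B)"
  unfolding thin_def
proof (intro allI impI)
  fix e :: real assume "e > 0"
  \<comment> \<open>The two sums add up, hence the half. The cap \<open>1\<close> keeps all radii at
    most \<open>1\<close>, so that raising the exponent from \<open>d\<close> to \<open>e\<close>
    does not increase any term.\<close>
  define d where "d = min 1 (e/2)"
  have d: "0 < d" "d \<le> 1" "d \<le> e/2" "d \<le> e" using \<open>e > 0\<close> by (auto simp: d_def)
  from assms d obtain xs ys where
    xs: "A \<subseteq> (\<Union>(p, r)\<in>set xs. cball p r)" "\<forall>(p, r)\<in>set xs. 0 < r \<and> r \<le> d" "(\<Sum>(p, r)\<leftarrow>xs. r powr d) \<le> d" and
    ys: "B \<subseteq> (\<Union>(p, r)\<in>set ys. cball p r)" "\<forall>(p, r)\<in>set ys. 0 < r \<and> r \<le> d" "(\<Sum>(p, r)\<leftarrow>ys. r powr d) \<le> d"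
    unfolding thin_def thin_cover_def by meson
  have "\<forall>(p, r)\<in>set (xs @ ys). 0 < r \<and> r \<le> 1"
    using xs(2) ys(2) d by fastforce
  then have "(\<Sum>(p, r)\<leftarrow>xs @ ys. r powr e) \<le> (\<Sum>(p, r)\<leftarrow>xs @ ys. r powr d)"
    by (rule sum_powr_antimono) (use d in simp)
  also have "\<dots> \<le> e" using xs(3) ys(3) d by simp
  finally have "(\<Sum>(p, r)\<leftarrow>xs @ ys. r powr e) \<le> e" .
  moreover have "\<forall>(p, r)\<in>set (xs @ ys). 0 < r \<and> r \<le> e"
    using xs(2) ys(2) d by fastforce
  moreover have "A \<union> B \<subseteq> (\<Union>(p, r)\<in>set (xs @ ys). cball p r)"
    using xs(1) ys(1) by auto
  ultimately show "thin_cover e (A \<union> B)"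
    unfolding thin_cover_def by blast
qed

lemma thin_UN: "finite I \<Longrightarrow> (\<And>i. i \<in> I \<Longrightarrow> thin (A i)) \<Longrightarrow> thin (\<Union>i\<in>I. A i)"
  by (induction I rule: finite_induct) (auto intro: thin_Un)

lemma thin_isometric_image:
  assumes "\<And>x y. dist (f x) (f y) = dist x y" and "thin A"
  shows "thin (f ` A)"
  unfolding thin_def
proof (intro allI impI)
  fix e :: real assume "e > 0"
  then obtain xs where
    xs: "A \<subseteq> (\<Union>(p, r)\<in>set xs. cball p r)" "\<forall>(p, r)\<in>set xs. 0 < r \<and> r \<le> e" "(\<Sum>(p, r)\<leftarrow>xs. r powr e) \<le> e"
    using assms(2) unfolding thin_def thin_cover_def by meson
  define ys where "ys = map (\<lambda>(p, r). (f p, r)) xs"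
  have "f ` A \<subseteq> (\<Union>(p, r)\<in>set ys. cball p r)"
  proof
    fix y assume "y \<in> f ` A"
    then obtain x p r where "y = f x" "(p, r) \<in> set xs" "x \<in> cball p r"
      using xs(1) by blast
    then have "(f p, r) \<in> set ys" "y \<in> cball (f p) r"
      by (force simp: ys_def, simp add: assms(1))
    then show "y \<in> (\<Union>(p, r)\<in>set ys. cball p r)" by blast
  qed
  moreover have "\<forall>(p, r)\<in>set ys. 0 < r \<and> r \<le> e" using xs(2) by (auto simp: ys_def)
  moreover have "(\<Sum>(p, r)\<leftarrow>ys. r powr e) \<le> e"
    using xs(3) by (simp add: ys_def o_def case_prod_unfold)
  ultimately show "thin_cover e (f ` A)" unfolding thin_cover_def by blast
qed

text \<open>Finitely many points cost arbitrarily little when covered by equally small balls. A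
  neighbourhood of positive radius is covered, not just \<open>F\<close>, so that the cover survives
  small perturbations of the points.\<close>

lemma ex_thin_cover_finite_nhd:
  assumes "finite F" and e: "e > 0"
  shows "\<exists>r>0. thin_cover e (\<Union>p\<in>F. cball p r)"
proof -
  \<comment> \<open>The second bound makes \<open>r powr e\<close> at most
    \<open>e / (card F + 1)\<close>; the summand \<open>1\<close> keeps this positive and well
    defined for empty \<open>F\<close>.\<close>
  define r where "r = min e ((e / (card F + 1)) powr (1/e))"
  have r: "0 < r" "r \<le> e" using e by (auto simp: r_def)
  have "r powr e \<le> ((e / (card F + 1)) powr (1/e)) powr e"
    using e r by (intro powr_mono2) (auto simp: r_def)
  also have "\<dots> = e / (card F + 1)" using e by (simp add: powr_powr)
  finally have "card F * (r powr e) \<le> card F * (e / (card F + 1))"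
    by (rule mult_left_mono) simp
  also have "\<dots> \<le> e" using e by (simp add: field_simps)
  finally have *: "card F * (r powr e) \<le> e" .
  obtain ps where ps: "set ps = F" "distinct ps" using assms(1) finite_distinct_list by blast
  have "thin_cover e (\<Union>p\<in>F. cball p r)"
    unfolding thin_cover_def
  proof (intro exI conjI)
    show "(\<Sum>(p, r)\<leftarrow>map (\<lambda>p. (p, r)) ps. r powr e) \<le> e"
      using * distinct_card[OF ps(2)] ps(1) by (simp add: o_def sum_list_triv)
  qed (use ps r in auto)
  with r show ?thesis by blast
qed

section \<open>Hausdorff measure and dimension of thin sets\<close>

lemma thin_hausdorff_measure:
  fixes A :: "'a::euclidean_space set"
  assumes "thin A" and s: "s > 0"
  shows "hausdorff_measure s A = 0"
proof -
  have small: "hausdorff_premeasure \<delta> s A \<le> ennreal \<epsilon>" if "\<delta> > 0" "\<epsilon> > 0" for \<delta> \<epsilon>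
  proof -
    \<comment> \<open>A ball of radius \<open>r\<close> has diameter \<open>2 * r\<close>: this
      explains \<open>\<delta>/2\<close> and the factor \<open>2 powr s\<close>. The bounds
      \<open>s\<close> and \<open>1\<close> allow passing from exponent \<open>e\<close> to exponent
      \<open>s\<close> without increasing the sum.\<close>
    define e where "e = min (min (\<delta>/2) (\<epsilon> / 2 powr s)) (min s 1)"
    have e0: "0 < e" "e \<le> \<delta>/2" "e \<le> \<epsilon> / 2 powr s" "e \<le> s" "e \<le> 1"
      using that s by (auto simp only: e_def min_le_iff_disj order_refl min_less_iff_conj zero_less_divide_iff
          zero_less_numeral powr_gt_zero zero_less_one)
    then have e: "0 < e" "2 * e \<le> \<delta>" "2 powr s * e \<le> \<epsilon>" "e \<le> s" "e \<le> 1"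
      by (simp_all add: field_simps)
    obtain xs where
      xs: "A \<subseteq> (\<Union>(p, r)\<in>set xs. cball p r)" "\<forall>(p, r)\<in>set xs. 0 < r \<and> r \<le> e" "(\<Sum>(p, r)\<leftarrow>xs. r powr e) \<le> e"
      using assms(1) e(1) unfolding thin_def thin_cover_def by meson
    \<comment> \<open>The finite cover is padded to a sequence by empty sets, which have weight
      \<open>0\<close>.\<close>
    define U where "U i = (if i < length xs then case xs ! i of (p, r) \<Rightarrow> cball p r else {})" for i
    have r: "0 < snd (xs ! i) \<and> snd (xs ! i) \<le> e" if "i < length xs" for i
      using xs(2) nth_mem[OF that] by (auto simp: case_prod_beta)
    have "A \<subseteq> (\<Union>i. U i)"
    proof
      fix x assume "x \<in> A"
      then obtain y where "y \<in> set xs" "x \<in> cball (fst y) (snd y)"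
        using xs(1) by (force simp: case_prod_beta)
      then obtain i where "i < length xs" "x \<in> cball (fst (xs ! i)) (snd (xs ! i))"
        by (metis in_set_conv_nth)
      then have "x \<in> U i" by (simp add: U_def case_prod_beta)
      then show "x \<in> (\<Union>i. U i)" by blast
    qed
    moreover have "bounded (U i) \<and> diameter (U i) \<le> \<delta>" for i
      using r[of i] e that(1) by (auto simp: U_def case_prod_beta)
    ultimately have "hausdorff_premeasure \<delta> s A \<le> (\<Sum>i. diameter_weight s (U i))"
      unfolding hausdorff_premeasure_def by (intro INF_lower) auto
    also have "\<dots> = (\<Sum>i<length xs. diameter_weight s (U i))"
      by (rule suminf_finite) (auto simp: U_def diameter_weight_def)
    also have "\<dots> = (\<Sum>i<length xs. ennreal ((2 * snd (xs ! i)) powr s))"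
    proof (rule sum.cong)
      fix i assume "i \<in> {..<length xs}"
      then show "diameter_weight s (U i) = ennreal ((2 * snd (xs ! i)) powr s)"
        using r[of i] s by (auto simp: U_def diameter_weight_def case_prod_beta)
    qed simp
    also have "\<dots> = ennreal (\<Sum>i<length xs. (2 * snd (xs ! i)) powr s)"
      by simp
    also have "(\<Sum>i<length xs. (2 * snd (xs ! i)) powr s) = 2 powr s * (\<Sum>(p, r)\<leftarrow>xs. r powr s)"
      using r by (simp add: sum_list_sum_nth case_prod_beta powr_mult less_imp_le sum_distrib_left lessThan_atLeast0)
    also have "\<dots> \<le> 2 powr s * (\<Sum>(p, r)\<leftarrow>xs. r powr e)"
      using xs(2) e by (intro mult_left_mono sum_powr_antimono) fastforce+
    also have "\<dots> \<le> \<epsilon>"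
      using xs(3) e(3) by (meson mult_left_mono order_trans powr_ge_zero)
    finally show ?thesis by (simp add: ennreal_leI)
  qed
  have "hausdorff_premeasure \<delta> s A = 0" if "\<delta> > 0" for \<delta>
    proof -
    have "hausdorff_premeasure \<delta> s A \<le> 0"
      by (rule ennreal_le_epsilon) (use small[OF that] in simp)
    then show ?thesis by simp
  qed
  then show ?thesis unfolding hausdorff_measure_def by (intro SUP_eq_const) auto
qed

lemma thin_hausdorff_dim:
  fixes A :: "'a::euclidean_space set"
  assumes "thin A"
  shows "hausdorff_dim A \<le> 0"
proof (cases "A = {}")
  case False
  have "Inf {ereal s |s. 0 \<le> s \<and> hausdorff_measure s A = 0} \<le> 0"
  proof (rule ereal_le_epsilon2)
    fix e :: real assume "0 < e"
    then have "ereal e \<in> {ereal s |s. 0 \<le> s \<and> hausdorff_measure s A = 0}"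
      using thin_hausdorff_measure[OF assms] by auto
    then show "Inf {ereal s |s. 0 \<le> s \<and> hausdorff_measure s A = 0} \<le> 0 + ereal e"
      by (simp only: add_0 Inf_lower)
  qed
  then show ?thesis using False by (simp add: hausdorff_dim_def)
qed (simp add: hausdorff_dim_def)

section \<open>The lower bound for the topological Hausdorff dimension\<close>

lemma hausdorff_dim_nonneg: "A \<noteq> {} \<Longrightarrow> 0 \<le> hausdorff_dim A"
  unfolding hausdorff_dim_def by (simp only: if_False) (rule Inf_greatest, clarsimp)

text \<open>If \<open>d < 1\<close>, the boundaries of the basis sets have negative dimension and so
  are empty. The basis sets are then clopen in \<open>K\<close>, and one that contains
  \<open>a\<close> but not \<open>b\<close> disconnects \<open>S\<close>.\<close>

lemma top_hausdorff_dim_ge_1: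
  fixes K :: "'a::metric_space set"
  assumes "connected S" "S \<subseteq> K" "a \<in> S" "b \<in> S" "a \<noteq> b"
  shows "1 \<le> top_hausdorff_dim K"
proof -
  have "1 \<le> d" if base: "base_of_topology (top_of_set K) \<U>"
    and dim: "\<forall>U\<in>\<U>. hausdorff_dim (top_of_set K frontier_of U) \<le> d - 1" for d :: ereal and \<U>
  proof (rule ccontr)
    assume "\<not> 1 \<le> d"
    then have "d - 1 < 0" by (simp add: ereal_minus_less)
    have "openin (top_of_set K) (K - {b})"
      by (metis openin_delete openin_subtopology_self)
    moreover have "a \<in> K - {b}" using assms by blast
    ultimately obtain U where U: "U \<in> \<U>" "a \<in> U" "U \<subseteq> K - {b}"
      using base unfolding base_of_topology_def by meson
    have "top_of_set K frontier_of U = {}"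
      using dim U(1) \<open>d - 1 < 0\<close> hausdorff_dim_nonneg by (metis leD le_less_trans)
    then have "closedin (top_of_set K) U" "openin (top_of_set K) U"
      using clopenin_eq_frontier_of[of "top_of_set K" U] U(3) by auto
    then obtain C V where "closed C" "U = K \<inter> C" "open V" "U = K \<inter> V"
      unfolding closedin_closed openin_open by blast
    then have "closedin (top_of_set S) (S \<inter> U)" "openin (top_of_set S) (S \<inter> U)"
      using assms(2) unfolding closedin_closed openin_open by (metis inf.absorb1 inf.assoc)+
    then have "S \<inter> U = {} \<or> S \<inter> U = S"
      using assms(1) unfolding connected_clopen by blast
    then show False using assms U by blast
  qed
  moreover have "K \<noteq> {}" using assms(2,3) by blast
  ultimately show ?thesis
    unfolding top_hausdorff_dim_def by (simp only: if_False) (rule Inf_greatest, blast)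
qed

subsection \<open>Bases with thin boundaries\<close>

text \<open>The frontier is taken in the ambient space and not relative to \<open>K\<close>. This
  gives a local condition that is easy to transport by isometries and to check for boxes.\<close>

definition thin_frontiers :: "'a::metric_space set \<Rightarrow> bool" where
  "thin_frontiers K \<longleftrightarrow>
     (\<forall>x\<in>K. \<forall>e>0. \<exists>V. open V \<and> x \<in> V \<and> V \<subseteq> ball x e \<and> thin (K \<inter> frontier V))"

text \<open>The boundary of \<open>K \<inter> V\<close> relative to \<open>K\<close> is contained in
  \<open>K \<inter> frontier V\<close>, so the traces on \<open>K\<close> of the open sets with thin
  frontier form a suitable basis.\<close>

lemma top_hausdorff_dim_le_1:
  fixes K :: "'a::euclidean_space set"
  assumes "thin_frontiers K" "K \<noteq> {}"
  shows "top_hausdorff_dim K \<le> 1"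
proof -
  define \<U> where "\<U> = {K \<inter> V |V. open V \<and> thin (K \<inter> frontier V)}"
  have "base_of_topology (top_of_set K) \<U>"
    unfolding base_of_topology_def
  proof (intro conjI ballI allI impI; (elim conjE)?)
    show "openin (top_of_set K) U" if "U \<in> \<U>" for U
      using that unfolding \<U>_def openin_open by blast
    fix W x assume W: "openin (top_of_set K) W" and x: "x \<in> W"
    obtain T where T: "open T" "W = K \<inter> T" using W unfolding openin_open by blast
    obtain e where e: "e > 0" "ball x e \<subseteq> T" using T x open_contains_ball by blast
    have "x \<in> K" using x T by blast
    then obtain V where V: "open V" "x \<in> V" "V \<subseteq> ball x e" "thin (K \<inter> frontier V)"
      using assms(1) e(1) unfolding thin_frontiers_def by meson
    show "\<exists>U\<in>\<U>. x \<in> U \<and> U \<subseteq> W"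
    proof (intro bexI conjI)
      show "K \<inter> V \<in> \<U>" using V unfolding \<U>_def by blast
      show "x \<in> K \<inter> V" "K \<inter> V \<subseteq> W" using V e T \<open>x \<in> K\<close> by auto
    qed
  qed
  moreover have "hausdorff_dim (top_of_set K frontier_of U) \<le> 1 - 1" if U: "U \<in> \<U>" for U
  proof -
    obtain V where V: "U = K \<inter> V" "open V" "thin (K \<inter> frontier V)"
      using U unfolding \<U>_def by blast
    have "openin (top_of_set K) U" using V openin_open by blast
    then have "top_of_set K frontier_of U = K \<inter> closure (K \<inter> V) - U"
      using V(1) by (simp add: frontier_of_openin closure_of_subtopology Int_absorb1)
    also have "\<dots> \<subseteq> K \<inter> frontier V"
      using V closure_mono[of "K \<inter> V" V] by (auto simp: frontier_def interior_open)
    finally have "thin (top_of_set K frontier_of U)" using V(3) thin_subset by blast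
    then have "hausdorff_dim (top_of_set K frontier_of U) \<le> 0" by (rule thin_hausdorff_dim)
    then show ?thesis by (simp add: one_ereal_def zero_ereal_def)
  qed
  ultimately have "1 \<in> {d. \<exists>\<U>. base_of_topology (top_of_set K) \<U> \<and>
      (\<forall>U\<in>\<U>. hausdorff_dim (top_of_set K frontier_of U) \<le> d - 1)}" by blast
  then show ?thesis
    using assms(2) unfolding top_hausdorff_dim_def by (simp only: if_False Inf_lower)
qed

text \<open>A surjective isometry is a homeomorphism of the ambient spaces, so it maps frontiers to
  frontiers.\<close>

lemma thin_frontiers_isometric_image:
  assumes iso: "\<And>x y. dist (f x) (f y) = dist x y" and "surj f" and "thin_frontiers K"
  shows "thin_frontiers (f ` K)"
  unfolding thin_frontiers_def
proof (intro ballI allI impI)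
  fix y e assume "y \<in> f ` K" and "(e::real) > 0"
  then obtain x where x: "x \<in> K" "y = f x" by blast
  then obtain V where V: "open V" "x \<in> V" "V \<subseteq> ball x e" "thin (K \<inter> frontier V)"
    using assms(3) \<open>e > 0\<close> unfolding thin_frontiers_def by meson
  have "inj f" using iso by (metis dist_eq_0_iff injI)
  have inv_iso: "dist (inv f x) (inv f y) = dist x y" for x y
    using iso[of "inv f x" "inv f y"] by (simp add: surj_f_inv_f[OF \<open>surj f\<close>])
  have cont: "continuous_on UNIV g" if "\<And>x y. dist (g x) (g y) = dist x y" for g :: "'c::metric_space \<Rightarrow> 'd::metric_space"
    unfolding continuous_on_iff using that by auto
  have "homeomorphic_maps euclidean euclidean f (inv f)"
    using cont[OF iso] cont[OF inv_iso] \<open>inj f\<close> \<open>surj f\<close>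
    by (auto simp: homeomorphic_maps_def surj_f_inv_f)
  then have hom: "homeomorphic_map euclidean euclidean f"
    using homeomorphic_map_maps by blast
  have "frontier (f ` V) = f ` frontier V"
    using homeomorphic_map_frontier_of[OF hom, of V] by simp
  then have "f ` K \<inter> frontier (f ` V) = f ` (K \<inter> frontier V)"
    using \<open>inj f\<close> by (simp add: image_Int)
  then have "thin (f ` K \<inter> frontier (f ` V))"
    using thin_isometric_image[OF iso V(4)] by simp
  moreover have "open (f ` V)"
    using homeomorphic_imp_open_map[OF hom] V(1) by (simp add: open_map_def)
  moreover have "f ` V \<subseteq> ball y e" using V(3) iso by (auto simp: x(2))
  ultimately show "\<exists>W. open W \<and> y \<in> W \<and> W \<subseteq> ball y e \<and> thin (f ` K \<inter> frontier W)"
    using V(2) x by blast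
qed

text \<open>A point of one set has positive distance from the other, so sufficiently small
  neighbourhoods have frontiers that miss the other set.\<close>

lemma thin_frontiers_Un_disjoint:
  assumes "thin_frontiers A" "thin_frontiers B" "closed A" "closed B" "A \<inter> B = {}"
  shows "thin_frontiers (A \<union> B)"
proof -
  have *: "\<exists>V. open V \<and> x \<in> V \<and> V \<subseteq> ball x e \<and> thin ((A \<union> B) \<inter> frontier V)"
    if A: "thin_frontiers A" "closed B" "A \<inter> B = {}" "x \<in> A" "e > 0" for A B :: "'a set" and x e
  proof -
    have "open (- B)" "x \<in> - B" using that by auto
    then obtain d where d: "d > 0" "ball x d \<subseteq> - B" using open_contains_ball by blast
    \<comment> \<open>Halving makes \<open>c\<close> strictly smaller than \<open>d\<close>: the
      frontier of \<open>V\<close> is only known to lie in the closed ball of radius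
      \<open>c\<close>.\<close>
    define c where "c = min (d/2) e"
    have c: "0 < c" "c < d" "c \<le> e" using d that by (auto simp: c_def)
    obtain V where V: "open V" "x \<in> V" "V \<subseteq> ball x c" "thin (A \<inter> frontier V)"
      using A c(1) unfolding thin_frontiers_def by meson
    have "frontier V \<subseteq> cball x c"
      using closure_minimal[of V "cball x c"] V(3) ball_subset_cball[of x c] by (fastforce simp: frontier_def)
    also have "\<dots> \<subseteq> ball x d" using c(2) by auto
    finally have "frontier V \<inter> B = {}" using d(2) by blast
    then have "(A \<union> B) \<inter> frontier V = A \<inter> frontier V" by blast
    moreover have "V \<subseteq> ball x e" using V(3) c(3) by auto
    ultimately show ?thesis using V by metis
  qed
  have "B \<inter> A = {}" using assms(5) by blast
  then show ?thesis
    unfolding thin_frontiers_def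
    using *[OF assms(1,4,5)] *[OF assms(2,3)] by (metis Un_iff Un_commute)
qed

subsection \<open>Sets of directions\<close>

definition has_segment :: "'a::real_normed_vector set \<Rightarrow> 'a \<Rightarrow> bool" where
  "has_segment K v \<longleftrightarrow> (\<exists>a r. 0 < r \<and> closed_segment a (a + r *\<^sub>R v) \<subseteq> K)"

definition realizable :: "'a::euclidean_space set \<Rightarrow> bool" where
  "realizable S \<longleftrightarrow>
     (\<exists>K. compact K \<and> thin_frontiers K \<and> (\<forall>v\<in>S. has_segment K v))"

lemma realizable_subset: "realizable T \<Longrightarrow> S \<subseteq> T \<Longrightarrow> realizable S"
  unfolding realizable_def by (meson subsetD)

lemma realizable_empty [simp]: "realizable {}"
  unfolding realizable_def by (rule exI[of _ "{}"]) (simp add: thin_frontiers_def)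

text \<open>Translation preserves the directions of segments. Moving one of the two compact sets far
  away makes them disjoint, so that neither adds points to the frontiers chosen for the
  other.\<close>

lemma realizable_Un:
  fixes S T :: "'a::euclidean_space set"
  assumes "realizable S" "realizable T"
  shows "realizable (S \<union> T)"
proof -
  obtain A where A: "compact A" "thin_frontiers A"
    "\<And>v. v \<in> S \<Longrightarrow> has_segment A v"
    using assms(1) unfolding realizable_def by blast
  obtain B where B: "compact B" "thin_frontiers B"
    "\<And>v. v \<in> T \<Longrightarrow> has_segment B v"
    using assms(2) unfolding realizable_def by blast
  obtain M where M: "\<And>x. x \<in> A \<Longrightarrow> norm x \<le> M" "\<And>x. x \<in> B \<Longrightarrow> norm x \<le> M"
    using compact_imp_bounded[OF compact_Un[OF A(1) B(1)]] unfolding bounded_iff by blast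
  \<comment> \<open>This norm exceeds that of any difference of points of \<open>A\<close> and
    \<open>B\<close>. The absolute value covers a negative \<open>M\<close>, possible if both sets
    are empty.\<close>
  obtain c :: 'a where c: "norm c = 2 * \<bar>M\<bar> + 1"
    using vector_choose_size[of "2 * \<bar>M\<bar> + 1"] by auto
  define B' where "B' = (+) c ` B"
  have "x \<noteq> c + y" if "x \<in> A" "y \<in> B" for x y
  proof
    assume "x = c + y"
    then have "norm c \<le> norm x + norm y" by (metis add_diff_cancel_right' norm_triangle_ineq4)
    then show False using M(1)[OF that(1)] M(2)[OF that(2)] c by linarith
  qed
  then have disj: "A \<inter> B' = {}" unfolding B'_def by blast
  have B'c: "compact B'" unfolding B'_def by (rule compact_translation[OF B(1)])
  have "thin_frontiers B'"
    unfolding B'_def by (rule thin_frontiers_isometric_image) (simp_all add: B(2))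
  then have "thin_frontiers (A \<union> B')"
    using A(1,2) B'c disj by (intro thin_frontiers_Un_disjoint compact_imp_closed)
  moreover have "has_segment (A \<union> B') v" if v: "v \<in> S \<union> T" for v
  proof (cases "v \<in> S")
    case True
    then show ?thesis using A(3) unfolding has_segment_def by (meson Un_iff subset_iff)
  next
    case False
    then obtain a r where "0 < r" "closed_segment a (a + r *\<^sub>R v) \<subseteq> B" using B(3)[of v] v unfolding has_segment_def by auto
    then have "closed_segment (c + a) ((c + a) + r *\<^sub>R v) \<subseteq> B'"
      using closed_segment_translation[of c a "a + r *\<^sub>R v"] by (auto simp: B'_def add.assoc)
    then show ?thesis using \<open>0 < r\<close> unfolding has_segment_def by blast
  qed
  ultimately show ?thesis
    unfolding realizable_def using A(1) B'c compact_Un by blast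
qed

lemma realizable_UN: "finite I \<Longrightarrow> (\<And>i. i \<in> I \<Longrightarrow> realizable (S i)) \<Longrightarrow> realizable (\<Union>i\<in>I. S i)"
  by (induction I rule: finite_induct) (auto intro: realizable_Un)

lemma realizable_orthogonal_image:
  fixes f :: "real ^ 'n \<Rightarrow> real ^ 'n"
  assumes f: "orthogonal_transformation f" and "realizable S"
  shows "realizable (f ` S)"
proof -
  have lin: "linear f" using f by (simp add: orthogonal_transformation_def)
  obtain A where A: "compact A" "thin_frontiers A"
    "\<And>v. v \<in> S \<Longrightarrow> has_segment A v"
    using assms(2) unfolding realizable_def by blast
  have "dist (f x) (f y) = dist x y" for x y
    using f by (simp add: dist_norm orthogonal_transformation flip: linear_diff[OF lin])
  then have "thin_frontiers (f ` A)"
    using A(2) orthogonal_transformation_surj[OF f] by (intro thin_frontiers_isometric_image)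
  moreover have "compact (f ` A)"
    using A(1) lin by (simp add: compact_continuous_image linear_continuous_on linear_conv_bounded_linear)
  moreover have "has_segment (f ` A) w" if w: "w \<in> f ` S" for w
  proof -
    obtain v where v: "v \<in> S" "w = f v" using w by blast
    obtain a r where r: "0 < r" "closed_segment a (a + r *\<^sub>R v) \<subseteq> A" using A(3)[OF v(1)] unfolding has_segment_def by blast
    have "closed_segment (f a) (f a + r *\<^sub>R w) = f ` closed_segment a (a + r *\<^sub>R v)"
      using closed_segment_linear_image[OF lin, of a "a + r *\<^sub>R v"]
      by (simp add: v(2) linear_add[OF lin] linear_scale[OF lin])
    then show ?thesis using r unfolding has_segment_def by (metis image_mono)
  qed
  ultimately show ?thesis unfolding realizable_def by blast
qed

subsection \<open>A generic family of segments\<close>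

text \<open>The Baire category argument for bounded functions on \<open>D\<close> with the supremum distance,
  applied to countably many properties \<open>Q k\<close> with dense interior.\<close>

lemma sup_norm_generic:
  fixes Q :: "nat \<Rightarrow> ('a \<Rightarrow> 'b::complete_space) \<Rightarrow> bool"
  assumes step: "\<And>k a e. bounded (a ` D) \<Longrightarrow> 0 < e \<Longrightarrow>
      \<exists>b d. 0 < d \<and> (\<forall>v\<in>D. dist (b v) (a v) \<le> e) \<and>
            (\<forall>c. (\<forall>v\<in>D. dist (c v) (b v) \<le> d) \<longrightarrow> Q k c)"
  shows "\<exists>a. bounded (a ` D) \<and> (\<forall>k. Q k a)"
proof -
  have bdd: "bounded (b ` D)" if a: "bounded (a ` D)" and b: "\<forall>v\<in>D. dist (b v) (a v) \<le> e" for a b :: "'a \<Rightarrow> 'b" and e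
  proof -
    obtain x M where "\<forall>v\<in>D. dist x (a v) \<le> M" using a unfolding bounded_def by auto
    then have "\<forall>v\<in>D. dist x (b v) \<le> M + e"
      using b by (metis add_mono dist_commute dist_triangle_le)
    then show ?thesis unfolding bounded_def by auto
  qed
  \<comment> \<open>A pair \<open>(a, d)\<close> stands for the closed ball of centre
    \<open>a\<close> and radius \<open>d\<close> in the supremum distance.\<close>
  define P where "P n x \<longleftrightarrow> (case x of (a, d) \<Rightarrow> bounded (a ` D) \<and> 0 < d \<and> d \<le> (1/2) ^ n)"
    for n :: nat and x :: "('a \<Rightarrow> 'b) \<times> real"
  \<comment> \<open>Moving the centre by at most \<open>d/2\<close> and at least halving the radius
    keeps the new ball inside the old one; moreover \<open>Q n\<close> holds throughout the new
    ball.\<close>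
  define R where "R n x y \<longleftrightarrow> (case x of (a, d) \<Rightarrow> case y of (b, d') \<Rightarrow>
      (\<forall>v\<in>D. dist (b v) (a v) \<le> d/2) \<and> d' \<le> d/2 \<and>
      (\<forall>c. (\<forall>v\<in>D. dist (c v) (b v) \<le> d') \<longrightarrow> Q n c))"
    for n :: nat and x y :: "('a \<Rightarrow> 'b) \<times> real"
  have "\<exists>f. \<forall>n. P n (f n) \<and> R n (f n) (f (Suc n))"
  proof (rule dependent_nat_choice)
    show "\<exists>x. P 0 x"
      by (rule exI[of _ "(\<lambda>_. undefined, 1)"]) (auto simp: P_def bounded_def)
    fix x n assume x: "P n x"
    obtain a d where ad: "x = (a, d)" by fastforce
    have a: "bounded (a ` D)" "0 < d" "d \<le> (1/2) ^ n" using x by (auto simp: P_def ad)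
    obtain b d' where b: "0 < d'" "\<forall>v\<in>D. dist (b v) (a v) \<le> d/2"
        "\<And>c. (\<forall>v\<in>D. dist (c v) (b v) \<le> d') \<Longrightarrow> Q n c"
      using step[of a "d/2" n] a by auto
    define d'' where "d'' = min d' (d/2)"
    have d'': "0 < d''" "d'' \<le> d'" "d'' \<le> d/2" using a b by (auto simp: d''_def)
    show "\<exists>y. P (Suc n) y \<and> R n x y"
    proof (intro exI conjI)
      show "P (Suc n) (b, d'')" using bdd[OF a(1) b(2)] d'' a by (simp add: P_def)
      have "\<forall>c. (\<forall>v\<in>D. dist (c v) (b v) \<le> d'') \<longrightarrow> Q n c" using b(3) d''(2) order_trans by blast
      then show "R n x (b, d'')" using b(2) d''(3) by (simp add: R_def ad)
    qed
  qed
  then obtain f where f: "\<And>n. P n (f n)" "\<And>n. R n (f n) (f (Suc n))" by blast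
  define a where "a n = fst (f n)" for n
  define d where "d n = snd (f n)" for n
  have P: "bounded (a n ` D)" "0 < d n" "d n \<le> (1/2) ^ n" for n
    using f(1)[of n] by (auto simp: P_def a_def d_def case_prod_unfold)
  have R: "v \<in> D \<Longrightarrow> dist (a (Suc n) v) (a n v) \<le> d n / 2" "d (Suc n) \<le> d n / 2"
     "(\<forall>v\<in>D. dist (c v) (a (Suc n) v) \<le> d (Suc n)) \<Longrightarrow> Q n c" for n v c
    using f(2)[of n] by (auto simp: R_def a_def d_def case_prod_unfold)
  \<comment> \<open>Each step moves the centre by at most \<open>d n / 2\<close>, which is at most
    \<open>d n - d (Suc n)\<close>; these differences telescope.\<close>
  have tel: "dist (a (n + j) v) (a n v) \<le> d n - d (n + j)" if "v \<in> D" for n j v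
  proof (induction j)
    case (Suc j)
    have "dist (a (n + Suc j) v) (a n v) \<le> dist (a (Suc (n + j)) v) (a (n + j) v) + dist (a (n + j) v) (a n v)"
      by (simp add: dist_triangle)
    then show ?case using Suc R(1)[OF that, of "n + j"] R(2)[of "n + j"] by simp
  qed simp
  have near: "dist (a m v) (a n v) \<le> d n" if "v \<in> D" "n \<le> m" for n m v
    using tel[OF that(1), of n "m - n"] that(2) P(2)[of m] by simp
  have "Cauchy (\<lambda>n. a n v)" if v: "v \<in> D" for v
  proof (rule metric_CauchyI)
    fix e :: real assume "0 < e"
    then obtain M where M: "(1/2) ^ M < e / 2"
      using real_arch_pow_inv[of "e/2" "1/2"] by auto
    have "dist (a m v) (a n v) < e" if "m \<ge> M" "n \<ge> M" for m n
      using near[OF v that(1)] near[OF v that(2)] P(3)[of M] M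
        dist_triangle2[of "a m v" "a n v" "a M v"] by linarith
    then show "\<exists>M. \<forall>m\<ge>M. \<forall>n\<ge>M. dist (a m v) (a n v) < e" by blast
  qed
  then have "\<forall>v\<in>D. \<exists>l. (\<lambda>n. a n v) \<longlonglongrightarrow> l"
    by (meson Cauchy_convergent convergent_def)
  then obtain l where l: "\<And>v. v \<in> D \<Longrightarrow> (\<lambda>n. a n v) \<longlonglongrightarrow> l v" by metis
  have lim: "\<forall>v\<in>D. dist (l v) (a n v) \<le> d n" for n
  proof
    fix v assume v: "v \<in> D"
    have "(\<lambda>m. dist (a m v) (a n v)) \<longlonglongrightarrow> dist (l v) (a n v)"
      by (intro tendsto_intros l v)
    then show "dist (l v) (a n v) \<le> d n"
      by (rule LIMSEQ_le_const2) (use near[OF v] in blast)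
  qed
  \<comment> \<open>The limit lies in all the balls, in particular in the one with index
    \<open>Suc k\<close>, on which \<open>Q k\<close> holds.\<close>
  have "Q k l" for k by (rule R(3)) (rule lim)
  then show ?thesis using bdd[OF P(1) lim[of 0]] by blast
qed

section \<open>Intersections of lines with coordinate hyperplanes\<close>

definition slice_point :: "'n \<Rightarrow> real \<Rightarrow> real ^ 'n \<Rightarrow> real ^ 'n \<Rightarrow> real ^ 'n" where
  "slice_point i t a v = a + ((t - a $ i) / v $ i) *\<^sub>R v"

lemma slice_point_nth: "v $ i \<noteq> 0 \<Longrightarrow> slice_point i t a v $ i = t"
  by (simp add: slice_point_def)

text \<open>The difference of the two points is \<open>a - b\<close> projected along
  \<open>v\<close> to the hyperplane of vectors with vanishing coordinate \<open>i\<close>. Since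
  \<open>v $ i\<close> is at least \<open>1\<close>, the correction has norm at most
  \<open>M * dist a b\<close>, uniformly in \<open>t\<close> and \<open>v\<close>.\<close>

lemma dist_slice_point_le:
  assumes "1 \<le> v $ i" "norm v \<le> M"
  shows "dist (slice_point i t a v) (slice_point i t b v) \<le> (1 + M) * dist a b"
proof -
  have "slice_point i t a v - slice_point i t b v = (a - b) - ((a - b) $ i / v $ i) *\<^sub>R v"
    using assms(1) by (simp add: slice_point_def algebra_simps diff_divide_distrib)
  then have "dist (slice_point i t a v) (slice_point i t b v)
      \<le> norm (a - b) + \<bar>(a - b) $ i / v $ i\<bar> * norm v"
    by (metis dist_norm norm_scaleR norm_triangle_ineq4)
  also have "\<bar>(a - b) $ i / v $ i\<bar> * norm v \<le> norm (a - b) * M"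
  proof (rule mult_mono)
    have "\<bar>(a - b) $ i / v $ i\<bar> \<le> \<bar>(a - b) $ i\<bar>"
      using assms(1) by (simp add: divide_le_eq mult_le_cancel_left1 del: vector_minus_component)
    also have "\<dots> \<le> norm (a - b)" by (rule component_le_norm_cart)
    finally show "\<bar>(a - b) $ i / v $ i\<bar> \<le> norm (a - b)" .
  qed (use assms in auto)
  finally show ?thesis by (simp add: dist_norm algebra_simps)
qed

text \<open>Each point is compared with that of the parallel line through the origin, whose norm is
  at most \<open>\<bar>t\<bar> * M\<close>.\<close>

lemma bounded_slice_points:
  assumes "bounded (a ` D)" "\<And>v. v \<in> D \<Longrightarrow> 1 \<le> v $ i" "\<And>v. v \<in> D \<Longrightarrow> norm v \<le> M"
  shows "bounded ((\<lambda>v. slice_point i t (a v) v) ` D)"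
proof -
  obtain B where B: "\<And>v. v \<in> D \<Longrightarrow> norm (a v) \<le> B"
    using assms(1) unfolding bounded_iff by auto
  have "dist 0 (slice_point i t (a v) v) \<le> \<bar>t\<bar> * M + (1 + M) * B" if v: "v \<in> D" for v
  proof -
    have "norm (slice_point i t 0 v) = \<bar>t\<bar> / v $ i * norm v"
      using assms(2)[OF v] by (simp add: slice_point_def)
    also have "\<dots> \<le> \<bar>t\<bar> * M"
      using assms(2,3)[OF v]
      by (intro mult_mono) (auto simp: divide_le_eq mult_le_cancel_left1)
    finally have "norm (slice_point i t 0 v) \<le> \<bar>t\<bar> * M" .
    moreover have "dist (slice_point i t (a v) v) (slice_point i t 0 v) \<le> (1 + M) * B"
    proof -
      have "0 \<le> M" using assms(3)[OF v] norm_ge_zero order_trans by blast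
      then have "(1 + M) * dist (a v) 0 \<le> (1 + M) * B"
        using B[OF v] by (intro mult_left_mono) auto
      then show ?thesis
        using dist_slice_point_le[of v i M t "a v" 0] assms(2,3)[OF v] by linarith
    qed
    ultimately show ?thesis
      using norm_triangle_ineq2[of "slice_point i t (a v) v" "slice_point i t 0 v"]
      by (simp add: dist_norm)
  qed
  then show ?thesis unfolding bounded_def by blast
qed

text \<open>The lines through \<open>a v\<close> in direction \<open>v\<close> are moved parallel to themselves so that their
  intersection points with the hyperplane are rounded to a finite net of that hyperplane.\<close>

lemma slice_rounding:
  fixes D :: "(real ^ 'n) set"
  assumes bdd: "bounded (a ` D)" and D: "\<And>v. v \<in> D \<Longrightarrow> 1 \<le> v $ i" "\<And>v. v \<in> D \<Longrightarrow> norm v \<le> M"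
    and e: "0 < e" and h: "0 < h"
  shows "\<exists>b d. 0 < d \<and> (\<forall>v\<in>D. dist (b v) (a v) \<le> e) \<and>
    (\<forall>c. (\<forall>v\<in>D. dist (c v) (b v) \<le> d) \<longrightarrow>
      (\<exists>C. closed C \<and> thin_cover h C \<and> (\<lambda>v. slice_point i t (c v) v) ` D \<subseteq> C))"
proof -
  define p where "p v = slice_point i t (a v) v" for v
  have "bounded (p ` D)" unfolding p_def using bounded_slice_points[OF bdd D] .
  then have "compact (closure (p ` D))" by simp
  then obtain F where F: "finite F" "F \<subseteq> closure (p ` D)" "closure (p ` D) \<subseteq> (\<Union>x\<in>F. ball x e)"
    using seq_compact_imp_totally_bounded e compact_eq_seq_compact_metric by metis
  \<comment> \<open>The net \<open>F\<close> is taken from this closure, so it lies in the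
    hyperplane too.\<close>
  have "closure (p ` D) \<subseteq> {x. x $ i = t}"
  proof (rule closure_minimal)
    show "p ` D \<subseteq> {x. x $ i = t}"
    proof clarify
      fix v assume "v \<in> D"
      then show "p v $ i = t" using D(1)[of v] slice_point_nth[of v i t "a v"] by (auto simp: p_def)
    qed
    show "closed {x :: real ^ 'n. x $ i = t}"
      by (intro closed_Collect_eq continuous_intros)
  qed
  then have Ft: "x $ i = t" if "x \<in> F" for x using F(2) that by blast
  have "\<exists>x\<in>F. dist x (p v) < e" if "v \<in> D" for v
    using F(3) closure_subset[of "p ` D"] that by fastforce
  then obtain q where q: "\<And>v. v \<in> D \<Longrightarrow> q v \<in> F" "\<And>v. v \<in> D \<Longrightarrow> dist (q v) (p v) < e" by metis
  \<comment> \<open>Both \<open>q v\<close> and \<open>p v\<close> lie in the hyperplane, so the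
    displacement does not change coordinate \<open>i\<close>, and the line through
    \<open>b v\<close> meets the hyperplane exactly in \<open>q v\<close>.\<close>
  define b where "b v = a v + (q v - p v)" for v
  have b: "slice_point i t (b v) v = q v" if "v \<in> D" for v
  proof -
    have "p v $ i = t" using D(1)[OF that] slice_point_nth[of v i t "a v"] by (auto simp: p_def)
    then have "b v $ i = a v $ i" using Ft[OF q(1)[OF that]] by (simp add: b_def)
    then show ?thesis by (simp add: slice_point_def b_def p_def)
  qed
  obtain r where r: "0 < r" "thin_cover h (\<Union>x\<in>F. cball x r)"
    using ex_thin_cover_finite_nhd[OF F(1) h] by blast
  \<comment> \<open>The denominator is a Lipschitz constant of the slice points. The absolute value
    keeps it positive when \<open>D\<close> is empty and \<open>M\<close> negative.\<close>
  define d where "d = r / (1 + \<bar>M\<bar>)"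
  have d: "0 < d" "(1 + \<bar>M\<bar>) * d = r" using r by (auto simp: d_def)
  show ?thesis
  proof (intro exI conjI allI impI ballI)
    show "0 < d" by fact
    show "dist (b v) (a v) \<le> e" if "v \<in> D" for v
      using q(2)[OF that] by (simp add: b_def dist_norm)
    fix c assume c: "\<forall>v\<in>D. dist (c v) (b v) \<le> d"
    show "closed (\<Union>x\<in>F. cball x r)" using F(1) by blast
    show "thin_cover h (\<Union>x\<in>F. cball x r)" by fact
    show "(\<lambda>v. slice_point i t (c v) v) ` D \<subseteq> (\<Union>x\<in>F. cball x r)"
    proof clarify
      fix v assume v: "v \<in> D"
      have "dist (slice_point i t (c v) v) (q v) \<le> (1 + \<bar>M\<bar>) * dist (c v) (b v)"
        using dist_slice_point_le[of v i "\<bar>M\<bar>" t "c v" "b v"] D[OF v] b[OF v] by simp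
      also have "\<dots> \<le> (1 + \<bar>M\<bar>) * d" using c v by (intro mult_left_mono) auto
      finally show "slice_point i t (c v) v \<in> (\<Union>x\<in>F. cball x r)"
        using q(1)[OF v] d(2) by (auto simp: dist_commute)
    qed
  qed
qed

text \<open>Points of the segments that converge to a point of the hyperplane need not lie in it.
  Sliding them into it along their own lines costs at most \<open>M\<close> times their error in
  coordinate \<open>i\<close>, which tends to \<open>0\<close>. So \<open>x\<close> is a limit of
  slice points, and these lie in the closed set \<open>C\<close>.\<close>

lemma closure_segments_slice:
  fixes D :: "(real ^ 'n) set"
  assumes D: "\<And>v. v \<in> D \<Longrightarrow> 1 \<le> v $ i" "\<And>v. v \<in> D \<Longrightarrow> norm v \<le> M"
    and C: "closed C" "(\<lambda>v. slice_point i t (a v) v) ` D \<subseteq> C"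
    and x: "x \<in> closure (\<Union>v\<in>D. closed_segment (a v) (a v + v))" "x $ i = t"
  shows "x \<in> C"
proof -
  obtain y where y: "\<And>n. y n \<in> (\<Union>v\<in>D. closed_segment (a v) (a v + v))" "y \<longlonglongrightarrow> x"
    using x(1) unfolding closure_sequential by blast
  then have "\<forall>n. \<exists>v\<in>D. \<exists>s. y n = a v + s *\<^sub>R v"
    by (fastforce simp: in_segment algebra_simps)
  then obtain v s where v: "\<And>n. v n \<in> D" "\<And>n. y n = a (v n) + s n *\<^sub>R v n" by metis
  \<comment> \<open>This point is on the line that carries \<open>y n\<close>, but possibly outside
    the segment; hence \<open>C\<close> has to control whole lines.\<close>
  define z where "z n = slice_point i t (a (v n)) (v n)" for n
  have zy: "norm (z n - y n) \<le> \<bar>t - y n $ i\<bar> * M" for n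
  proof -
    have vi: "1 \<le> v n $ i" and vM: "norm (v n) \<le> M" using D v(1) by auto
    have "z n - y n = ((t - y n $ i) / v n $ i) *\<^sub>R v n"
      using vi by (simp add: z_def slice_point_def v(2) diff_divide_distrib add_divide_distrib algebra_simps)
    then have "norm (z n - y n) = \<bar>(t - y n $ i) / v n $ i\<bar> * norm (v n)" by simp
    also have "\<dots> \<le> \<bar>t - y n $ i\<bar> * M"
      using vi vM by (intro mult_mono) (auto simp: divide_le_eq mult_le_cancel_left1)
    finally show ?thesis .
  qed
  have "(\<lambda>n. \<bar>t - y n $ i\<bar> * M) \<longlonglongrightarrow> \<bar>t - x $ i\<bar> * M"
    by (intro tendsto_intros y)
  then have "(\<lambda>n. \<bar>t - y n $ i\<bar> * M) \<longlonglongrightarrow> 0" using x(2) by simp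
  then have "(\<lambda>n. z n - y n) \<longlonglongrightarrow> 0"
    by (rule Lim_null_comparison[rotated]) (use zy in simp)
  from tendsto_add[OF this y(2)] have "z \<longlonglongrightarrow> x" by simp
  moreover have "z n \<in> C" for n using C(2) v(1) by (auto simp: z_def)
  ultimately show ?thesis using C(1) closed_sequentially by blast
qed

lemma ex_thin_slices:
  fixes D :: "(real ^ 'n) set"
  assumes D: "\<And>v i. v \<in> D \<Longrightarrow> 1 \<le> v $ i" "\<And>v. v \<in> D \<Longrightarrow> norm v \<le> M"
  shows "\<exists>a. bounded (a ` D) \<and>
    (\<forall>i. \<forall>t\<in>\<rat>. thin (closure (\<Union>v\<in>D. closed_segment (a v) (a v + v)) \<inter> {x. x $ i = t}))"
proof -
  \<comment> \<open>There are only countably many requirements: a coordinate, a rational level and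
    an accuracy \<open>1 / Suc m\<close>, together coded by \<open>k\<close>. Closedness of
    \<open>C\<close> makes the cover valid for the closure of the segments as well.\<close>
  define Q where "Q k a \<longleftrightarrow> (case from_nat k of (i, t, m) \<Rightarrow>
      \<exists>C. closed C \<and> thin_cover (1 / Suc m) C \<and>
          (\<lambda>v. slice_point i (of_rat t) (a v) v) ` D \<subseteq> C)"
    for k and a :: "real ^ 'n \<Rightarrow> real ^ 'n"
  have "\<exists>a. bounded (a ` D) \<and> (\<forall>k. Q k a)"
  proof (rule sup_norm_generic)
    show "\<exists>b d. 0 < d \<and> (\<forall>v\<in>D. dist (b v) (a v) \<le> e) \<and>
            (\<forall>c. (\<forall>v\<in>D. dist (c v) (b v) \<le> d) \<longrightarrow> Q k c)"
      if "bounded (a ` D)" "0 < e" for k and a :: "real ^ 'n \<Rightarrow> real ^ 'n" and e :: real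
    proof -
      obtain i t m where k: "from_nat k = (i :: 'n, t :: rat, m :: nat)"
        by (metis prod_cases3)
      show ?thesis
        unfolding Q_def k prod.case
        by (rule slice_rounding[OF that(1) D that(2)]) auto
    qed
  qed
  then obtain a where a: "bounded (a ` D)" "\<And>k. Q k a" by blast
  let ?K = "closure (\<Union>v\<in>D. closed_segment (a v) (a v + v))"
  have "thin (?K \<inter> {x. x $ i = of_rat t})" for i t
    unfolding thin_def
  proof (intro allI impI)
    fix e :: real assume "e > 0"
    then obtain m where m: "1 / Suc m < e"
      using nat_approx_posE by blast
    obtain C where C: "closed C" "thin_cover (1 / Suc m) C"
        "(\<lambda>v. slice_point i (of_rat t) (a v) v) ` D \<subseteq> C"
      using a(2)[of "to_nat (i, t, m)"] by (auto simp: Q_def)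
    have "?K \<inter> {x. x $ i = of_rat t} \<subseteq> C"
      using closure_segments_slice[OF D C(1,3)] by blast
    then have "thin_cover (1 / Suc m) (?K \<inter> {x. x $ i = of_rat t})"
      using C(2) thin_cover_subset by blast
    then show "thin_cover e (?K \<inter> {x. x $ i = of_rat t})"
      by (rule thin_cover_mono) (use m in auto)
  qed
  then show ?thesis using a(1) by (auto elim!: Rats_cases)
qed

text \<open>Small boxes with rational corners serve as neighbourhoods: their faces lie in finitely
  many rational slices, which are thin for the generic choice of \<open>a\<close>. Boundedness of
  \<open>a\<close> gives compactness.\<close>

lemma realizable_cube:
  "realizable {v :: real ^ 'n. \<forall>i. 1 \<le> v $ i \<and> v $ i \<le> 2}" (is "realizable ?D")
proof -
  have D: "1 \<le> v $ i" "norm v \<le> 2 * CARD('n)" if "v \<in> ?D" for v i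
  proof -
    have "norm v \<le> (\<Sum>i\<in>UNIV. \<bar>v $ i\<bar>)" by (rule norm_le_l1_cart)
    also have "\<dots> \<le> (\<Sum>i\<in>(UNIV :: 'n set). 2)"
    proof (rule sum_mono)
      fix i
      have "1 \<le> v $ i \<and> v $ i \<le> 2" using that by blast
      then show "\<bar>v $ i\<bar> \<le> 2" by simp
    qed
    finally show "norm v \<le> 2 * CARD('n)" by simp
  qed (use that in auto)
  obtain a where a: "bounded (a ` ?D)"
    "\<forall>i. \<forall>t\<in>\<rat>. thin (closure (\<Union>v\<in>?D. closed_segment (a v) (a v + v)) \<inter> {x. x $ i = t})"
    using ex_thin_slices[OF D] by blast
  define S where "S = (\<Union>v\<in>?D. closed_segment (a v) (a v + v))"
  obtain B where B: "\<And>v. v \<in> ?D \<Longrightarrow> norm (a v) \<le> B"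
    using a(1) unfolding bounded_iff by auto
  have "norm x \<le> B + 2 * CARD('n)" if x: "x \<in> S" for x
  proof -
    obtain v where v: "v \<in> ?D" "x \<in> closed_segment (a v) (a v + v)"
      using x unfolding S_def by blast
    have "norm (x - a v) \<le> norm v"
      using segment_bound(1)[OF v(2)] by simp
    then show ?thesis
      using norm_triangle_ineq2[of x "a v"] B[OF v(1)] D(2)[OF v(1)] by linarith
  qed
  then have "bounded S" unfolding bounded_iff by blast
  then have "compact (closure S)" by simp
  moreover have "thin_frontiers (closure S)"
    unfolding thin_frontiers_def
  proof (intro ballI allI impI)
    fix x e assume "(e::real) > 0"
    then obtain l u :: "real ^ 'n" where lu: "\<forall>i\<in>Basis. l \<bullet> i \<in> \<rat> \<and> u \<bullet> i \<in> \<rat>"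
        "x \<in> box l u" "box l u \<subseteq> ball x e"
      using rational_boxes by blast
    have rat: "l $ i \<in> \<rat>" "u $ i \<in> \<rat>" for i
      using lu(1) by (auto simp: Basis_vec_def inner_axis)
    have "frontier (box l u) \<subseteq> (\<Union>i. {x. x $ i = l $ i} \<union> {x. x $ i = u $ i})"
    proof
      fix y assume "y \<in> frontier (box l u)"
      then have "y \<in> cbox l u" "y \<notin> box l u" by (auto simp: frontier_box split: if_splits)
      then obtain i where "l $ i \<le> y $ i" "y $ i \<le> u $ i" "\<not> (l $ i < y $ i \<and> y $ i < u $ i)"
        unfolding mem_box_cart by blast
      then have "y $ i = l $ i \<or> y $ i = u $ i" by linarith
      then show "y \<in> (\<Union>i. {x. x $ i = l $ i} \<union> {x. x $ i = u $ i})" by blast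
    qed
    then have "closure S \<inter> frontier (box l u) \<subseteq>
        (\<Union>i. (closure S \<inter> {x. x $ i = l $ i}) \<union> (closure S \<inter> {x. x $ i = u $ i}))"
      by blast
    moreover have "thin (\<Union>i. (closure S \<inter> {x. x $ i = l $ i}) \<union> (closure S \<inter> {x. x $ i = u $ i}))"
      using a(2) rat unfolding S_def by (intro thin_UN thin_Un) auto
    ultimately have "thin (closure S \<inter> frontier (box l u))" using thin_subset by blast
    then show "\<exists>V. open V \<and> x \<in> V \<and> V \<subseteq> ball x e \<and> thin (closure S \<inter> frontier V)"
      using lu open_box by blast
  qed
  moreover have "has_segment (closure S) v" if "v \<in> ?D" for v
    unfolding has_segment_def
  proof (intro exI conjI)
    show "closed_segment (a v) (a v + 1 *\<^sub>R v) \<subseteq> closure S"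
      using that closure_subset[of S] unfolding S_def by (simp, blast)
  qed simp
  ultimately show ?thesis unfolding realizable_def by blast
qed

section \<open>From a cube of directions to the sphere\<close>

lemma realizable_cone:
  fixes S :: "'a::euclidean_space set"
  assumes "realizable S"
  shows "realizable {v. \<exists>c>0. c *\<^sub>R v \<in> S}"
proof -
  have "has_segment K v" if K: "has_segment K (c *\<^sub>R v)" "0 < c" for K and v :: 'a and c
  proof -
    obtain a r where "0 < r" "closed_segment a (a + r *\<^sub>R (c *\<^sub>R v)) \<subseteq> K"
      using K(1) unfolding has_segment_def by blast
    then have "0 < r * c" "closed_segment a (a + (r * c) *\<^sub>R v) \<subseteq> K" using \<open>0 < c\<close> by auto
    then show ?thesis unfolding has_segment_def by blast
  qed
  then show ?thesis using assms unfolding realizable_def by blast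
qed

text \<open>The directions served by the cube contain an open neighbourhood \<open>N\<close> of the
  diagonal unit vector \<open>w\<close>. Rotating \<open>w\<close> to every point of the sphere
  gives an open cover by orthogonal images of \<open>N\<close>, and compactness leaves finitely many
  of them.\<close>

lemma realizable_sphere: "realizable (sphere (0 :: real ^ 'n) 1)"
proof -
  let ?S = "sphere (0 :: real ^ 'n) 1"
  let ?D = "{v :: real ^ 'n. \<forall>i. 1 \<le> v $ i \<and> v $ i \<le> 2}"
  \<comment> \<open>Scaling by \<open>c\<close> takes the diagonal unit vector to the centre of the
    cube; the strict inequalities in \<open>N\<close> make it open.\<close>
  define c where "c = norm ((\<chi> i. 3/2) :: real ^ 'n)"
  define N where "N = {v :: real ^ 'n. \<forall>i. 1 < (c *\<^sub>R v) $ i \<and> (c *\<^sub>R v) $ i < 2}"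
  have "((\<chi> i. 3/2) :: real ^ 'n) \<noteq> 0" by (simp add: vec_eq_iff)
  then have c: "c > 0" by (simp add: c_def)
  have "realizable N"
  proof (rule realizable_subset[OF realizable_cone[OF realizable_cube]])
    show "N \<subseteq> {v. \<exists>c>0. c *\<^sub>R v \<in> ?D}"
    proof
      fix v assume "v \<in> N"
      then have "c *\<^sub>R v \<in> ?D" unfolding N_def mem_Collect_eq by (meson less_imp_le)
      then show "v \<in> {v. \<exists>c>0. c *\<^sub>R v \<in> ?D}" using c by blast
    qed
  qed
  have "N = (\<lambda>v. c *\<^sub>R v) -` box (\<chi> i. 1) (\<chi> i. 2)"
    by (auto simp: N_def mem_box_cart)
  then have "open N"
    by (simp only:) (intro open_vimage open_box continuous_intros)
  define w where "w = (1 / c) *\<^sub>R ((\<chi> i. 3/2) :: real ^ 'n)"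
  have w: "norm w = 1" "w \<in> N" using c by (auto simp: w_def N_def c_def[symmetric])
  have "\<exists>f. orthogonal_transformation f \<and> f w = u" if "u \<in> ?S" for u
    using orthogonal_transformation_exists[of w u] w(1) that by auto
  then obtain f where f: "\<And>u. u \<in> ?S \<Longrightarrow> orthogonal_transformation (f u)"
      "\<And>u. u \<in> ?S \<Longrightarrow> f u w = u" by metis
  have op: "open (f u ` N)" if "u \<in> ?S" for u
    using f(1)[OF that] \<open>open N\<close>
    by (intro open_surjective_linear_image orthogonal_transformation_surj) (auto simp: orthogonal_transformation_def)
  have cover: "?S \<subseteq> (\<Union>u\<in>?S. f u ` N)"
  proof
    fix u assume u: "u \<in> ?S"
    then have "u \<in> f u ` N" using imageI[OF w(2), of "f u"] f(2)[OF u] by simp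
    with u show "u \<in> (\<Union>u\<in>?S. f u ` N)" by (rule UN_I)
  qed
  obtain U where U: "U \<subseteq> ?S" "finite U" "?S \<subseteq> (\<Union>u\<in>U. f u ` N)"
    by (rule compactE_image[OF compact_sphere _ cover]) (erule op)
  have "realizable (\<Union>u\<in>U. f u ` N)"
  proof (rule realizable_UN[OF U(2)])
    show "realizable (f u ` N)" if "u \<in> U" for u
      using realizable_orthogonal_image[OF f(1) \<open>realizable N\<close>] U(1) that by blast
  qed
  then show ?thesis using U(3) by (rule realizable_subset)
qed

theorem theorem5p6:
  shows "\<exists>K :: (real ^ 'n) set. compact K \<and> kakeya_set K \<and> top_hausdorff_dim K = 1"
proof -
  obtain K :: "(real ^ 'n) set" where K: "compact K" "thin_frontiers K"
    "\<And>v. v \<in> sphere 0 1 \<Longrightarrow> has_segment K v"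
    using realizable_sphere unfolding realizable_def by blast
  \<comment> \<open>A single non-degenerate segment in \<open>K\<close> is enough for the lower
    bound.\<close>
  obtain v :: "real ^ 'n" where v: "norm v = 1" using vector_choose_size[of 1] by auto
  obtain a r where r: "0 < r" "closed_segment a (a + r *\<^sub>R v) \<subseteq> K"
    using K(3)[of v] v unfolding has_segment_def by auto
  have "1 \<le> top_hausdorff_dim K"
    by (rule top_hausdorff_dim_ge_1[OF connected_segment(1) r(2), of a "a + r *\<^sub>R v"]) (use r v in auto)
  moreover have "top_hausdorff_dim K \<le> 1"
    using K(2) r(2) by (intro top_hausdorff_dim_le_1) auto
  moreover have "kakeya_set K"
    unfolding kakeya_set_def using K(3) by (simp add: has_segment_def)
  ultimately show ?thesis using K(1) by (metis order_antisym)
qed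

end
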